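(* Let $A$ be an algebra and let $I$ be a subsemigroup of $\mathrm{End}(A)$. Suppose that $A$ is any of finitely generated, $I$-representable or eventually $I$-separable. \begin{enumerate} \item There is a natural homomorphism $\sigma:\Omega(I)\to\Omega(I/{\approx})$ given by $(\lambda,\rho)\sigma=(\bar\lambda,\bar\rho)$, where $\bar\lambda,\bar\rho: I/{\approx}\to I/{\approx}$ are well-defined by $$\bar\lambda([[\alpha]])=[[\lambda(\alpha)]]\quad\text{and}\quad[[\alpha]]\bar\rho=[[\alpha\rho]]$$ for all $[[\alpha]]\in I/{\approx}$. \item If $\phi\in T(A,I)$, then $(\lambda_\phi,\rho_\phi)\sigma=(\lambda_{\bar\phi},\rho_{\bar\phi})$. \end{enumerate}
   Context: An algebra is a set $A$ with a collection of finitary operations; $\mathrm{End}(A)$ is its endomorphism monoid and $\mathcal{T}_A$ the monoid of all maps $A\to A$. Maps of $A$ are written on the right and composed left to right. Subsemigroups are non-empty; $\mathbb{N}$ is the set of positive integers. Translations. A right translation of a semigroup $J$ is a map $\rho:J\to J$ (written on the right) with $(\alpha\beta)\rho=\alpha(\beta\rho)$; a left translation is a map $\lambda:J\to J$ (written on the left) with $\lambda(\alpha\beta)=\lambda(\alpha)\beta$. A pair $(\lambda,\rho)$ of a left and a right translation is a bi-translation if $\alpha\lambda(\beta)=(\alpha\rho)\beta$ for all $\alpha,\beta\in J$. $\Omega(J)$ is the set of all bi-translations of $J$, a semigroup under $(\lambda,\rho)(\lambda',\rho')=(\lambda\lambda',\rho\rho')$, where $(\lambda\lambda')(\alpha)=\lambda(\lambda'(\alpha))$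 and $\alpha(\rho\rho')=(\alpha\rho)\rho'$. $T(A,I)=\{f\in\mathcal{T}_A: f\alpha\in I\text{ and }\alpha f\in I\text{ for all }\alpha\in I\}$. For such $f$, $\lambda_f(\alpha)=f\alpha$ and $\alpha\rho_f=\alpha f$ ($\alpha\in I$); the same notation is used with $A/{\sim}$ and $I/{\approx}$ (defined below) in place of $A$ and $I$. For $k\in\mathbb{N}$, $x\sim_k y$ in $A$ if and only if $x\alpha=y\alpha$ for all $\alpha\in I^k$ (products of $k$ elements of $I$), and ${\sim}=\bigcup_{k\in\mathbb{N}}{\sim_k}$; these are congruences on $A$. $[a]$ is the $\sim$-class of $a$. The congruence $\approx$ on $I$ is given by $\alpha\approx\beta$ if and only if $a\alpha\sim a\beta$ for all $a\in A$; $[[\alpha]]$ is the $\approx$-class of $\alpha$. $I/{\approx}$ is regarded as a subsemigroup of $\mathrm{End}(A/{\sim})$ via $[a][[\alpha]]=[a\alpha]$. For $\phi\in T(A,I)$, $\bar\phi:A/{\sim}\to A/{\sim}$ is the (well-defined) map $[a]\bar\phi=[a\phi]$; it lies in the idealiser of $I/{\approx}$ in $\mathcal{T}_{A/{\sim}}$. $A$ is $I$-representable if $\bigcup_{\alpha\in I}\mathrm{Im}\,\alpha$ generates $A$ as an algebra. $A$ is eventually $I$-separable if ${\sim_k}={\sim_{k+1}}$ for some $k\in\mathbb{N}$. *)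

theory Defs
  imports "HOL-Algebra.Group"
begin

section \<open>Algebras, subalgebras generated by a set, endomorphisms\<close>

record ('a, 'f) alg = "'a partial_object" +
  symbols :: "'f set"
  arity :: "'f \<Rightarrow> nat"
  interp :: "'f \<Rightarrow> 'a list \<Rightarrow> 'a"

definition args :: "('a, 'f) alg \<Rightarrow> 'f \<Rightarrow> 'a list set" where
  "args A f = {xs. length xs = arity A f \<and> set xs \<subseteq> carrier A}"

definition is_alg :: "('a, 'f) alg \<Rightarrow> bool" where
  "is_alg A \<longleftrightarrow> (\<forall>f\<in>symbols A. \<forall>xs\<in>args A f. interp A f xs \<in> carrier A)"

inductive_set subalg_gen :: "('a, 'f) alg \<Rightarrow> 'a set \<Rightarrow> 'a set" for A X where
  base: "x \<in> X \<Longrightarrow> x \<in> subalg_gen A X"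
| step: "f \<in> symbols A \<Longrightarrow> length xs = arity A f \<Longrightarrow> \<forall>x\<in>set xs. x \<in> subalg_gen A X
    \<Longrightarrow> interp A f xs \<in> subalg_gen A X"

definition finitely_generated :: "('a, 'f) alg \<Rightarrow> bool" where
  "finitely_generated A \<longleftrightarrow> (\<exists>X. finite X \<and> X \<subseteq> carrier A \<and> subalg_gen A X = carrier A)"

text \<open>Maps of a set \<open>X\<close> are the extensional functions \<open>X \<rightarrow>\<^sub>E X\<close>, so that equality of maps is
  equality in HOL.\<close>

definition End_alg :: "('a, 'f) alg \<Rightarrow> ('a \<Rightarrow> 'a) set" where
  "End_alg A = {\<alpha> \<in> carrier A \<rightarrow>\<^sub>E carrier A.
     \<forall>f\<in>symbols A. \<forall>xs\<in>args A f. \<alpha> (interp A f xs) = interp A f (map \<alpha> xs)}"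

text \<open>Left-to-right composition: \<open>x (\<alpha>\<beta>) = (x\<alpha>)\<beta>\<close> for maps written on the right.\<close>

definition rcomp :: "'a set \<Rightarrow> ('a \<Rightarrow> 'a) \<Rightarrow> ('a \<Rightarrow> 'a) \<Rightarrow> ('a \<Rightarrow> 'a)" where
  "rcomp X \<alpha> \<beta> = compose X \<beta> \<alpha>"

definition subsemigroup_of :: "'s set \<Rightarrow> ('s \<Rightarrow> 's \<Rightarrow> 's) \<Rightarrow> 's set \<Rightarrow> bool" where
  "subsemigroup_of S m J \<longleftrightarrow> J \<noteq> {} \<and> J \<subseteq> S \<and> (\<forall>x\<in>J. \<forall>y\<in>J. m x y \<in> J)"

definition representable :: "('a, 'f) alg \<Rightarrow> ('a \<Rightarrow> 'a) set \<Rightarrow> bool" where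
  "representable A I \<longleftrightarrow> subalg_gen A (\<Union>\<alpha>\<in>I. \<alpha> ` carrier A) = carrier A"


section \<open>Bi-translations of a semigroup with carrier \<open>J\<close> and multiplication \<open>m\<close>\<close>

definition right_translation :: "'s set \<Rightarrow> ('s \<Rightarrow> 's \<Rightarrow> 's) \<Rightarrow> ('s \<Rightarrow> 's) \<Rightarrow> bool" where
  "right_translation J m r \<longleftrightarrow> r \<in> J \<rightarrow>\<^sub>E J \<and> (\<forall>x\<in>J. \<forall>y\<in>J. r (m x y) = m x (r y))"

definition left_translation :: "'s set \<Rightarrow> ('s \<Rightarrow> 's \<Rightarrow> 's) \<Rightarrow> ('s \<Rightarrow> 's) \<Rightarrow> bool" where
  "left_translation J m l \<longleftrightarrow> l \<in> J \<rightarrow>\<^sub>E J \<and> (\<forall>x\<in>J. \<forall>y\<in>J. l (m x y) = m (l x) y)"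

definition bi_translation :: "'s set \<Rightarrow> ('s \<Rightarrow> 's \<Rightarrow> 's) \<Rightarrow> ('s \<Rightarrow> 's) \<times> ('s \<Rightarrow> 's) \<Rightarrow> bool" where
  "bi_translation J m = (\<lambda>(l, r). left_translation J m l \<and> right_translation J m r \<and>
     (\<forall>x\<in>J. \<forall>y\<in>J. m x (l y) = m (r x) y))"

text \<open>Left translations compose right-to-left, right translations left-to-right.\<close>

definition Omega :: "'s set \<Rightarrow> ('s \<Rightarrow> 's \<Rightarrow> 's) \<Rightarrow> (('s \<Rightarrow> 's) \<times> ('s \<Rightarrow> 's)) monoid" where
  "Omega J m = \<lparr>carrier = Collect (bi_translation J m),
     mult = (\<lambda>(l, r) (l', r'). (compose J l l', compose J r' r)),
     one = (\<lambda>x\<in>J. x, \<lambda>x\<in>J. x)\<rparr>"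


section \<open>Semigroups \<open>I\<close> of maps of a set \<open>X\<close>\<close>

text \<open>The set \<open>T(X, I)\<close>, the idealiser of \<open>I\<close> in the monoid of all maps of \<open>X\<close>.\<close>

definition idealiser :: "'a set \<Rightarrow> ('a \<Rightarrow> 'a) set \<Rightarrow> ('a \<Rightarrow> 'a) set" where
  "idealiser X I = {f \<in> X \<rightarrow>\<^sub>E X. \<forall>\<alpha>\<in>I. rcomp X f \<alpha> \<in> I \<and> rcomp X \<alpha> f \<in> I}"

definition lam :: "'a set \<Rightarrow> ('a \<Rightarrow> 'a) set \<Rightarrow> ('a \<Rightarrow> 'a) \<Rightarrow> ('a \<Rightarrow> 'a) \<Rightarrow> ('a \<Rightarrow> 'a)" where
  "lam X I f = (\<lambda>\<alpha>\<in>I. rcomp X f \<alpha>)"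

definition rho :: "'a set \<Rightarrow> ('a \<Rightarrow> 'a) set \<Rightarrow> ('a \<Rightarrow> 'a) \<Rightarrow> ('a \<Rightarrow> 'a) \<Rightarrow> ('a \<Rightarrow> 'a)" where
  "rho X I f = (\<lambda>\<alpha>\<in>I. rcomp X \<alpha> f)"

text \<open>\<open>ipow X I k\<close> is \<open>I\<^sup>k\<close>; the empty product (the identity map) only starts the recursion, and
  \<open>I\<^sup>0\<close> plays no role below.\<close>

primrec ipow :: "'a set \<Rightarrow> ('a \<Rightarrow> 'a) set \<Rightarrow> nat \<Rightarrow> ('a \<Rightarrow> 'a) set" where
  "ipow X I 0 = {\<lambda>x\<in>X. x}"
| "ipow X I (Suc k) = {rcomp X \<alpha> \<beta> | \<alpha> \<beta>. \<alpha> \<in> ipow X I k \<and> \<beta> \<in> I}"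

definition sim_k :: "'a set \<Rightarrow> ('a \<Rightarrow> 'a) set \<Rightarrow> nat \<Rightarrow> ('a \<times> 'a) set" where
  "sim_k X I k = {(x, y). x \<in> X \<and> y \<in> X \<and> (\<forall>\<alpha>\<in>ipow X I k. \<alpha> x = \<alpha> y)}"

definition sim :: "'a set \<Rightarrow> ('a \<Rightarrow> 'a) set \<Rightarrow> ('a \<times> 'a) set" where
  "sim X I = (\<Union>k\<in>{1..}. sim_k X I k)"

definition eventually_separable :: "'a set \<Rightarrow> ('a \<Rightarrow> 'a) set \<Rightarrow> bool" where
  "eventually_separable X I \<longleftrightarrow> (\<exists>k\<ge>1. sim_k X I k = sim_k X I (k + 1))"

definition approx :: "'a set \<Rightarrow> ('a \<Rightarrow> 'a) set \<Rightarrow> (('a \<Rightarrow> 'a) \<times> ('a \<Rightarrow> 'a)) set" where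
  "approx X I = {(\<alpha>, \<beta>). \<alpha> \<in> I \<and> \<beta> \<in> I \<and> (\<forall>a\<in>X. (\<alpha> a, \<beta> a) \<in> sim X I)}"

text \<open>The map \<open>[a] \<mapsto> [a\<phi>]\<close> of \<open>X/\<sim>\<close>; the union runs over equal classes
  (see \<open>bar_map_class\<close> below).\<close>

definition bar_map :: "'a set \<Rightarrow> ('a \<Rightarrow> 'a) set \<Rightarrow> ('a \<Rightarrow> 'a) \<Rightarrow> 'a set \<Rightarrow> 'a set" where
  "bar_map X I \<phi> = (\<lambda>C\<in>X // sim X I. \<Union>a\<in>C. sim X I `` {\<phi> a})"

text \<open>The map \<open>[a] \<mapsto> [a\<alpha>]\<close> of \<open>X/\<sim>\<close> given by a \<open>\<approx>\<close>-class \<open>D\<close> of maps \<open>\<alpha>\<close>. The semigroup \<open>I/\<approx>\<close>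
  is regarded as a semigroup of maps of \<open>X/\<sim>\<close> through the embedding \<open>class_act\<close>.\<close>

definition class_act :: "'a set \<Rightarrow> ('a \<Rightarrow> 'a) set \<Rightarrow> ('a \<Rightarrow> 'a) set \<Rightarrow> 'a set \<Rightarrow> 'a set" where
  "class_act X I D = (\<lambda>C\<in>X // sim X I. \<Union>\<alpha>\<in>D. \<Union>a\<in>C. sim X I `` {\<alpha> a})"

definition I_quot :: "'a set \<Rightarrow> ('a \<Rightarrow> 'a) set \<Rightarrow> ('a set \<Rightarrow> 'a set) set" where
  "I_quot X I = class_act X I ` (I // approx X I)"

definition I_class :: "'a set \<Rightarrow> ('a \<Rightarrow> 'a) set \<Rightarrow> ('a \<Rightarrow> 'a) \<Rightarrow> 'a set \<Rightarrow> 'a set" where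
  "I_class X I \<alpha> = class_act X I (approx X I `` {\<alpha>})"


section \<open>Well-definedness\<close>

lemma rcomp_apply: "x \<in> X \<Longrightarrow> rcomp X \<alpha> \<beta> x = \<beta> (\<alpha> x)"
  by (simp add: rcomp_def compose_def)

lemma rcomp_in: "\<alpha> \<in> X \<rightarrow>\<^sub>E X \<Longrightarrow> \<beta> \<in> X \<rightarrow>\<^sub>E X \<Longrightarrow> rcomp X \<alpha> \<beta> \<in> X \<rightarrow>\<^sub>E X"
  by (auto simp: rcomp_def compose_def)

lemma rcomp_assoc: "\<alpha> \<in> X \<rightarrow>\<^sub>E X \<Longrightarrow> rcomp X (rcomp X \<alpha> \<beta>) \<gamma> = rcomp X \<alpha> (rcomp X \<beta> \<gamma>)"
  by (auto simp: rcomp_def compose_def fun_eq_iff)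

lemma rcomp_id: "\<alpha> \<in> X \<rightarrow>\<^sub>E X \<Longrightarrow> rcomp X (\<lambda>x\<in>X. x) \<alpha> = \<alpha>"
  by (auto simp: rcomp_def compose_def fun_eq_iff PiE_def extensional_def)

lemma subsemigroup_maps:
  assumes "subsemigroup_of (End_alg A) (rcomp (carrier A)) I"
  shows "subsemigroup_of (carrier A \<rightarrow>\<^sub>E carrier A) (rcomp (carrier A)) I"
  using assms by (auto simp: subsemigroup_of_def End_alg_def)

context
  fixes X :: "'a set" and I
  assumes sg: "subsemigroup_of (X \<rightarrow>\<^sub>E X) (rcomp X) I"
begin

lemma I_maps: "I \<subseteq> X \<rightarrow>\<^sub>E X" and I_mult: "\<alpha> \<in> I \<Longrightarrow> \<beta> \<in> I \<Longrightarrow> rcomp X \<alpha> \<beta> \<in> I"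
  using sg by (auto simp: subsemigroup_of_def)

lemma I_idealiser: "I \<subseteq> idealiser X I"
  using I_maps I_mult by (auto simp: idealiser_def)

lemma idealiserD:
  assumes "\<phi> \<in> idealiser X I"
  shows "\<phi> \<in> X \<rightarrow>\<^sub>E X" "\<alpha> \<in> I \<Longrightarrow> rcomp X \<phi> \<alpha> \<in> I" "\<alpha> \<in> I \<Longrightarrow> rcomp X \<alpha> \<phi> \<in> I"
  using assms unfolding idealiser_def by simp_all

lemma ipow_1: "ipow X I (Suc 0) = I"
proof -
  have "\<And>\<beta>. \<beta> \<in> I \<Longrightarrow> rcomp X (\<lambda>x\<in>X. x) \<beta> = \<beta>"
    using I_maps by (intro rcomp_id) blast
  then show ?thesis by force
qed

lemma ipow_maps: "ipow X I k \<subseteq> X \<rightarrow>\<^sub>E X"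
proof (induction k)
  case (Suc k)
  then show ?case using I_maps by (auto intro!: rcomp_in)
qed simp

lemma idealiser_ipow:
  assumes "\<phi> \<in> idealiser X I"
  shows "\<beta> \<in> ipow X I (Suc k) \<Longrightarrow> rcomp X \<phi> \<beta> \<in> ipow X I (Suc k)"
proof (induction k arbitrary: \<beta>)
  case 0
  then show ?case using assms unfolding ipow_1 by (auto simp: idealiser_def)
next
  case (Suc k)
  from Suc.prems obtain \<gamma> \<delta> where *: "\<beta> = rcomp X \<gamma> \<delta>" "\<gamma> \<in> ipow X I (Suc k)" "\<delta> \<in> I"
    unfolding ipow.simps(2)[of X I "Suc k"] by blast
  have "rcomp X \<phi> \<beta> = rcomp X (rcomp X \<phi> \<gamma>) \<delta>"
    using assms unfolding * by (subst rcomp_assoc) (auto simp: idealiser_def)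
  then show ?case using Suc.IH[OF *(2)] *(3) unfolding ipow.simps(2)[of X I "Suc k"] by blast
qed

lemma sim_k_mono: "k \<le> l \<Longrightarrow> sim_k X I k \<subseteq> sim_k X I l"
proof (induction l rule: dec_induct)
  case (step l)
  have "sim_k X I l \<subseteq> sim_k X I (Suc l)"
    by (auto simp: sim_k_def rcomp_apply)
  with step show ?case by blast
qed simp

lemma equiv_sim: "equiv X (sim X I)"
proof (rule equivI)
  show "sim X I \<subseteq> X \<times> X" by (auto simp: sim_def sim_k_def)
  show "refl_on X (sim X I)" by (auto simp: refl_on_def sim_def sim_k_def)
  show "sym (sim X I)" by (fastforce simp: sym_def sim_def sim_k_def)
  show "trans (sim X I)"
  proof (rule transI)
    fix x y z assume "(x, y) \<in> sim X I" "(y, z) \<in> sim X I"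
    then obtain k l where kl: "k \<ge> 1" "(x, y) \<in> sim_k X I k" "(y, z) \<in> sim_k X I l"
      by (auto simp: sim_def)
    then have "(x, y) \<in> sim_k X I (max k l)" "(y, z) \<in> sim_k X I (max k l)"
      using sim_k_mono[of k "max k l"] sim_k_mono[of l "max k l"] by auto
    then have "(x, z) \<in> sim_k X I (max k l)" by (auto simp: sim_k_def)
    then show "(x, z) \<in> sim X I" using kl(1) unfolding sim_def by (intro UN_I[of "max k l"]) auto
  qed
qed

lemma sim_idealiser:
  assumes "\<phi> \<in> idealiser X I" "(x, y) \<in> sim X I"
  shows "(\<phi> x, \<phi> y) \<in> sim X I"
proof -
  obtain k where k: "k \<ge> 1" "(x, y) \<in> sim_k X I k" using assms(2) by (auto simp: sim_def)
  have xy: "x \<in> X" "y \<in> X" and e: "\<And>\<alpha>. \<alpha> \<in> ipow X I k \<Longrightarrow> \<alpha> x = \<alpha> y"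
    using k by (auto simp: sim_k_def)
  have "\<beta> (\<phi> x) = \<beta> (\<phi> y)" if "\<beta> \<in> ipow X I k" for \<beta>
  proof -
    have "rcomp X \<phi> \<beta> \<in> ipow X I k"
      using idealiser_ipow[OF assms(1), of \<beta> "k - 1"] k(1) that by simp
    from e[OF this] show ?thesis using xy by (simp add: rcomp_apply)
  qed
  moreover have "\<phi> x \<in> X" "\<phi> y \<in> X" using xy assms(1) by (auto simp: idealiser_def)
  ultimately have "(\<phi> x, \<phi> y) \<in> sim_k X I k" by (auto simp: sim_k_def)
  then show ?thesis using k(1) unfolding sim_def by (intro UN_I[of k]) auto
qed

lemma bar_map_class:
  assumes "\<phi> \<in> idealiser X I" "a \<in> X"
  shows "bar_map X I \<phi> (sim X I `` {a}) = sim X I `` {\<phi> a}"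
proof -
  have "(\<lambda>x. sim X I `` {\<phi> x}) respects sim X I"
    by (rule congruentI) (rule equiv_class_eq[OF equiv_sim sim_idealiser[OF assms(1)]])
  then show ?thesis
    using UN_equiv_class[OF equiv_sim _ assms(2)] assms(2)
    by (simp add: bar_map_def quotientI)
qed

lemma bar_map_eqI:
  assumes "\<phi> \<in> idealiser X I" "\<psi> \<in> X // sim X I \<rightarrow>\<^sub>E X // sim X I"
    "\<And>a. a \<in> X \<Longrightarrow> \<psi> (sim X I `` {a}) = sim X I `` {\<phi> a}"
  shows "\<psi> = bar_map X I \<phi>"
proof
  fix C
  show "\<psi> C = bar_map X I \<phi> C"
  proof (cases "C \<in> X // sim X I")
    case True
    then obtain a where "a \<in> X" "C = sim X I `` {a}" by (auto elim: quotientE)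
    then show ?thesis using assms(1,3) by (simp add: bar_map_class)
  next
    case False
    then show ?thesis using assms(2) by (auto simp: bar_map_def PiE_def extensional_def)
  qed
qed

lemma bar_map_maps:
  assumes "\<phi> \<in> idealiser X I"
  shows "bar_map X I \<phi> \<in> X // sim X I \<rightarrow>\<^sub>E X // sim X I"
proof (rule PiE_I)
  fix C assume "C \<in> X // sim X I"
  then obtain a where "a \<in> X" "C = sim X I `` {a}" by (auto elim: quotientE)
  then show "bar_map X I \<phi> C \<in> X // sim X I"
    using assms by (auto simp: bar_map_class idealiser_def intro!: quotientI)
qed (auto simp: bar_map_def)

lemma bar_map_mult:
  assumes "\<phi> \<in> idealiser X I" "\<psi> \<in> idealiser X I" "rcomp X \<phi> \<psi> \<in> idealiser X I"
  shows "rcomp (X // sim X I) (bar_map X I \<phi>) (bar_map X I \<psi>) = bar_map X I (rcomp X \<phi> \<psi>)"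
proof (rule bar_map_eqI[OF assms(3)])
  show "rcomp (X // sim X I) (bar_map X I \<phi>) (bar_map X I \<psi>) \<in> X // sim X I \<rightarrow>\<^sub>E X // sim X I"
    using assms by (intro rcomp_in bar_map_maps)
  fix a assume a: "a \<in> X"
  then have "\<phi> a \<in> X" using assms(1) by (auto simp: idealiser_def)
  then show "rcomp (X // sim X I) (bar_map X I \<phi>) (bar_map X I \<psi>) (sim X I `` {a})
      = sim X I `` {rcomp X \<phi> \<psi> a}"
    using a assms(1,2) by (simp add: rcomp_apply bar_map_class quotientI)
qed

lemma equiv_approx: "equiv I (approx X I)"
proof (rule equivI)
  show "approx X I \<subseteq> I \<times> I" by (auto simp: approx_def)
  show "refl_on I (approx X I)"
    using I_maps equiv_sim by (fastforce simp: refl_on_def approx_def equiv_def)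
  show "sym (approx X I)" using equiv_sim by (auto simp: approx_def equiv_def sym_def)
  show "trans (approx X I)"
    using equiv_sim by (intro transI) (auto simp: approx_def equiv_def elim: transE)
qed

lemma I_class_bar_map:
  assumes "\<alpha> \<in> I"
  shows "I_class X I \<alpha> = bar_map X I \<alpha>"
proof -
  have "(\<Union>\<beta>\<in>approx X I `` {\<alpha>}. \<Union>a\<in>C. sim X I `` {\<beta> a}) = (\<Union>a\<in>C. sim X I `` {\<alpha> a})"
    if C: "C \<in> X // sim X I" for C
  proof -
    have "sim X I `` {\<beta> a} = sim X I `` {\<alpha> a}" if "(\<alpha>, \<beta>) \<in> approx X I" "a \<in> C" for \<beta> a
    proof -
      have "a \<in> X" using that(2) C in_quotient_imp_subset[OF equiv_sim] by blast
      then show ?thesis using that equiv_class_eq[OF equiv_sim] by (auto simp: approx_def)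
    qed
    moreover have "\<alpha> \<in> approx X I `` {\<alpha>}" using equiv_class_self[OF equiv_approx assms] .
    ultimately show ?thesis by blast
  qed
  then show ?thesis unfolding I_class_def class_act_def bar_map_def by (intro restrict_ext) auto
qed

lemma I_class_apply: "\<alpha> \<in> I \<Longrightarrow> a \<in> X \<Longrightarrow> I_class X I \<alpha> (sim X I `` {a}) = sim X I `` {\<alpha> a}"
  using I_idealiser by (simp add: I_class_bar_map bar_map_class subsetD)

lemma I_class_eq_iff:
  assumes "\<alpha> \<in> I" "\<beta> \<in> I"
  shows "I_class X I \<alpha> = I_class X I \<beta> \<longleftrightarrow> (\<alpha>, \<beta>) \<in> approx X I"
proof
  assume eq: "I_class X I \<alpha> = I_class X I \<beta>"
  have "(\<alpha> a, \<beta> a) \<in> sim X I" if a: "a \<in> X" for a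
  proof -
    have "sim X I `` {\<alpha> a} = sim X I `` {\<beta> a}" using I_class_apply assms a eq by metis
    then show ?thesis using a assms I_maps by (subst (asm) eq_equiv_class_iff[OF equiv_sim]) blast+
  qed
  then show "(\<alpha>, \<beta>) \<in> approx X I" using assms by (auto simp: approx_def)
next
  assume "(\<alpha>, \<beta>) \<in> approx X I"
  then show "I_class X I \<alpha> = I_class X I \<beta>"
    unfolding I_class_def using equiv_class_eq[OF equiv_approx] by metis
qed

lemma I_quot_eq: "I_quot X I = I_class X I ` I"
  by (auto simp: I_quot_def I_class_def quotient_def)

lemma class_act_inj: "inj_on (class_act X I) (I // approx X I)"
proof (rule inj_onI)
  fix C D assume "C \<in> I // approx X I" "D \<in> I // approx X I" "class_act X I C = class_act X I D"
  moreover from this obtain \<alpha> \<beta> where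
    "\<alpha> \<in> I" "C = approx X I `` {\<alpha>}" "\<beta> \<in> I" "D = approx X I `` {\<beta>}" by (auto elim!: quotientE)
  ultimately show "C = D"
    using I_class_eq_iff[of \<alpha> \<beta>] equiv_class_eq[OF equiv_approx, of \<alpha> \<beta>] by (simp add: I_class_def)
qed

lemma I_class_mult:
  assumes "\<alpha> \<in> I" "\<beta> \<in> I"
  shows "rcomp (X // sim X I) (I_class X I \<alpha>) (I_class X I \<beta>) = I_class X I (rcomp X \<alpha> \<beta>)"
proof -
  have "\<alpha> \<in> idealiser X I" "\<beta> \<in> idealiser X I" "rcomp X \<alpha> \<beta> \<in> idealiser X I"
    using I_idealiser I_mult assms by blast+
  from bar_map_mult[OF this] show ?thesis using assms I_mult by (simp add: I_class_bar_map)
qed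

lemma bar_map_idealiser:
  assumes \<phi>: "\<phi> \<in> idealiser X I"
  shows "bar_map X I \<phi> \<in> idealiser (X // sim X I) (I_quot X I)"
proof -
  have "rcomp (X // sim X I) (bar_map X I \<phi>) (I_class X I \<alpha>) \<in> I_quot X I \<and>
    rcomp (X // sim X I) (I_class X I \<alpha>) (bar_map X I \<phi>) \<in> I_quot X I" if \<alpha>: "\<alpha> \<in> I" for \<alpha>
  proof -
    have i: "rcomp X \<phi> \<alpha> \<in> I" "rcomp X \<alpha> \<phi> \<in> I" using idealiserD[OF \<phi>] \<alpha> by simp_all
    have j: "\<alpha> \<in> idealiser X I" "rcomp X \<phi> \<alpha> \<in> idealiser X I" "rcomp X \<alpha> \<phi> \<in> idealiser X I"
      using i \<alpha> I_idealiser by blast+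
    show ?thesis
      unfolding I_class_bar_map[OF \<alpha>] bar_map_mult[OF \<phi> j(1,2)] bar_map_mult[OF j(1) \<phi> j(3)]
      using i I_class_bar_map unfolding I_quot_eq by (metis imageI)
  qed
  then show ?thesis using bar_map_maps[OF \<phi>] unfolding idealiser_def I_quot_eq by blast
qed

lemma lam_rho_bi_translation:
  assumes "\<phi> \<in> idealiser X I"
  shows "(lam X I \<phi>, rho X I \<phi>) \<in> carrier (Omega I (rcomp X))"
proof -
  note idealiserD[OF assms]
  moreover have "\<And>\<alpha> \<beta> \<gamma>. \<alpha> \<in> I \<Longrightarrow> rcomp X (rcomp X \<alpha> \<beta>) \<gamma> = rcomp X \<alpha> (rcomp X \<beta> \<gamma>)"
    using I_maps by (intro rcomp_assoc) blast
  ultimately show ?thesis using I_mult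
    by (simp add: Omega_def bi_translation_def left_translation_def right_translation_def
        lam_def rho_def rcomp_assoc del: PiE_iff)
qed

end


section \<open>The quotient algebra\<close>

definition quot_alg :: "('a, 'f) alg \<Rightarrow> ('a \<times> 'a) set \<Rightarrow> ('a set, 'f) alg" where
  "quot_alg A r = \<lparr>carrier = carrier A // r, symbols = symbols A, arity = arity A,
     interp = (\<lambda>f Cs. \<Union>xs\<in>listset Cs. r `` {interp A f xs})\<rparr>"

lemma listset_iff: "xs \<in> listset Cs \<longleftrightarrow> list_all2 (\<in>) xs Cs"
  by (induction Cs arbitrary: xs) (auto simp: set_Cons_def list_all2_Cons2)

lemma sim_list:
  assumes "subsemigroup_of (X \<rightarrow>\<^sub>E X) (rcomp X) I" "list_all2 (\<lambda>x y. (x, y) \<in> sim X I) xs ys"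
  shows "\<exists>k\<ge>1. list_all2 (\<lambda>x y. (x, y) \<in> sim_k X I k) xs ys"
  using assms(2)
proof (induction rule: list_all2_induct)
  case (Cons x xs y ys)
  then obtain k l where kl: "k \<ge> 1" "list_all2 (\<lambda>x y. (x, y) \<in> sim_k X I k) xs ys"
    "(x, y) \<in> sim_k X I l" by (auto simp: sim_def)
  have "list_all2 (\<lambda>x y. (x, y) \<in> sim_k X I (max k l)) xs ys"
    using kl(2) by (rule list_all2_mono) (use sim_k_mono[OF assms(1), of k "max k l"] in auto)
  moreover have "(x, y) \<in> sim_k X I (max k l)"
    using kl(3) sim_k_mono[OF assms(1), of l "max k l"] by auto
  ultimately show ?case using kl(1) by (intro exI[of _ "max k l"]) auto
qed auto

lemma End_rcomp:
  assumes "is_alg A" "\<alpha> \<in> End_alg A" "\<beta> \<in> End_alg A"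
  shows "rcomp (carrier A) \<alpha> \<beta> \<in> End_alg A"
proof -
  have 1: "\<alpha> \<in> carrier A \<rightarrow>\<^sub>E carrier A" "\<beta> \<in> carrier A \<rightarrow>\<^sub>E carrier A"
    using assms by (auto simp: End_alg_def)
  have "rcomp (carrier A) \<alpha> \<beta> (interp A f xs) = interp A f (map (rcomp (carrier A) \<alpha> \<beta>) xs)"
    if f: "f \<in> symbols A" "xs \<in> args A f" for f xs
  proof -
    have "map \<alpha> xs \<in> args A f" using f(2) 1(1) by (auto simp: args_def)
    moreover have "map (rcomp (carrier A) \<alpha> \<beta>) xs = map \<beta> (map \<alpha> xs)"
      using f(2) by (auto simp: args_def rcomp_apply)
    moreover have "interp A f xs \<in> carrier A" using assms(1) f by (auto simp: is_alg_def)
    ultimately show ?thesis using assms(2,3) f by (simp add: rcomp_apply End_alg_def del: map_map map_eq_conv)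
  qed
  with rcomp_in[OF 1] show ?thesis by (auto simp: End_alg_def)
qed

context
  fixes A :: "('a, 'f) alg" and I
  assumes A: "is_alg A" and I: "subsemigroup_of (End_alg A) (rcomp (carrier A)) I"
begin

lemma ipow_End: "ipow (carrier A) I k \<subseteq> End_alg A"
proof (induction k)
  case 0
  have "map (\<lambda>x\<in>carrier A. x) xs = xs" if "set xs \<subseteq> carrier A" for xs
    using that by (intro map_idI) auto
  then show ?case using A by (auto simp: End_alg_def args_def is_alg_def)
next
  case (Suc k)
  then show ?case using I by (auto simp: subsemigroup_of_def intro!: End_rcomp[OF A])
qed

lemma sim_congruence:
  assumes "f \<in> symbols A" "xs \<in> args A f" "list_all2 (\<lambda>x y. (x, y) \<in> sim (carrier A) I) xs ys"
  shows "(interp A f xs, interp A f ys) \<in> sim (carrier A) I"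
proof -
  obtain k where k: "k \<ge> 1" "list_all2 (\<lambda>x y. (x, y) \<in> sim_k (carrier A) I k) xs ys"
    using sim_list[OF subsemigroup_maps[OF I] assms(3)] by blast
  have ys: "ys \<in> args A f" using k(2) assms(2)
    by (fastforce simp: args_def list_all2_conv_all_nth sim_k_def in_set_conv_nth)
  have "\<alpha> (interp A f xs) = \<alpha> (interp A f ys)" if \<alpha>: "\<alpha> \<in> ipow (carrier A) I k" for \<alpha>
  proof -
    have "map \<alpha> xs = map \<alpha> ys"
      using k(2) \<alpha> by (intro nth_equalityI) (auto simp: list_all2_conv_all_nth sim_k_def)
    moreover have "\<alpha> \<in> End_alg A" using ipow_End \<alpha> by blast
    ultimately show ?thesis using assms ys by (auto simp: End_alg_def)
  qed
  then have "(interp A f xs, interp A f ys) \<in> sim_k (carrier A) I k"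
    using A assms ys by (auto simp: sim_k_def is_alg_def)
  then show ?thesis using k(1) unfolding sim_def by (intro UN_I[of k]) auto
qed

lemma quot_interp:
  assumes "f \<in> symbols A" "xs \<in> args A f"
  shows "interp (quot_alg A (sim (carrier A) I)) f (map (\<lambda>x. sim (carrier A) I `` {x}) xs)
    = sim (carrier A) I `` {interp A f xs}"
proof -
  note eq = equiv_sim[OF subsemigroup_maps[OF I]]
  have "sim (carrier A) I `` {interp A f ys} = sim (carrier A) I `` {interp A f xs}"
    if "ys \<in> listset (map (\<lambda>x. sim (carrier A) I `` {x}) xs)" for ys
  proof -
    have "list_all2 (\<lambda>x y. (x, y) \<in> sim (carrier A) I) xs ys"
      using that by (auto simp: listset_iff list_all2_conv_all_nth)
    from equiv_class_eq[OF eq sim_congruence[OF assms this]] show ?thesis by simp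
  qed
  moreover have "xs \<in> listset (map (\<lambda>x. sim (carrier A) I `` {x}) xs)"
    using assms(2) equiv_class_self[OF eq]
    by (auto simp: listset_iff list_all2_conv_all_nth args_def subset_code(1))
  ultimately show ?thesis unfolding quot_alg_def alg.simps by (intro UN_constant_eq) blast+
qed

lemma I_quot_subsemigroup:
  "subsemigroup_of (End_alg (quot_alg A (sim (carrier A) I)))
     (rcomp (carrier A // sim (carrier A) I)) (I_quot (carrier A) I)"
proof -
  let ?X = "carrier A" and ?s = "sim (carrier A) I"
  note sg = subsemigroup_maps[OF I]
  have "I_class ?X I \<alpha> \<in> End_alg (quot_alg A ?s)" if \<alpha>: "\<alpha> \<in> I" for \<alpha>
  proof -
    have \<alpha>': "\<alpha> \<in> idealiser ?X I" "\<alpha> \<in> End_alg A" "\<alpha> \<in> ?X \<rightarrow>\<^sub>E ?X"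
      using I_idealiser[OF sg] I_maps[OF sg] I \<alpha> by (auto simp: subsemigroup_of_def)
    have "I_class ?X I \<alpha> (interp (quot_alg A ?s) f Cs)
        = interp (quot_alg A ?s) f (map (I_class ?X I \<alpha>) Cs)"
      if f: "f \<in> symbols A" and Cs: "length Cs = arity A f" "set Cs \<subseteq> ?X // ?s" for f Cs
    proof -
      have "\<forall>C\<in>set Cs. \<exists>a\<in>?X. C = ?s `` {a}" using Cs(2) by (auto elim: quotientE)
      then obtain g where g: "\<And>C. C \<in> set Cs \<Longrightarrow> g C \<in> ?X \<and> C = ?s `` {g C}" by metis
      define xs where "xs = map g Cs"
      have xs: "xs \<in> args A f" using g Cs(1) by (auto simp: xs_def args_def)
      have Cs_xs: "Cs = map (\<lambda>x. ?s `` {x}) xs"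
        using g unfolding xs_def map_map by (intro map_idI[symmetric]) auto
      have "map (I_class ?X I \<alpha>) Cs = map (\<lambda>x. ?s `` {x}) (map \<alpha> xs)"
        using xs \<alpha> I_class_apply[OF sg \<alpha>] unfolding Cs_xs by (auto simp: args_def)
      moreover have "map \<alpha> xs \<in> args A f" using xs \<alpha>'(3) by (auto simp: args_def)
      moreover have "interp A f xs \<in> ?X" using A f xs by (auto simp: is_alg_def)
      ultimately show ?thesis
        using f xs \<alpha>'(2) I_class_apply[OF sg \<alpha>] unfolding Cs_xs
        by (auto simp: quot_interp End_alg_def simp del: map_map)
    qed
    moreover have "I_class ?X I \<alpha> \<in> ?X // ?s \<rightarrow>\<^sub>E ?X // ?s"
      using bar_map_maps[OF sg \<alpha>'(1)] I_class_bar_map[OF sg \<alpha>] by simp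
    ultimately show ?thesis by (auto simp: End_alg_def args_def quot_alg_def)
  qed
  moreover have "I \<noteq> {}" using I by (auto simp: subsemigroup_of_def)
  ultimately show ?thesis
    using I_class_mult[OF sg] I_mult[OF sg] unfolding I_quot_eq[OF sg] subsemigroup_of_def by auto
qed

end

end

theory Submission
  imports Defs
begin

text \<open>Both members of a bi-translation \<open>(\<lambda>, \<rho>)\<close> of \<open>I\<close> respect \<open>\<approx>\<close>. For \<open>\<rho>\<close> this holds always, since
  \<open>a(\<alpha>\<rho>)\<gamma> = a\<alpha>\<lambda>(\<gamma>)\<close> and \<open>\<lambda>\<close> preserves \<open>I\<^sup>k\<close>. For \<open>\<lambda>\<close>: if \<open>a = b\<gamma>\<close> with \<open>\<gamma> \<in> I\<close>, then
  \<open>a\<lambda>(\<alpha>) = b(\<gamma>\<rho>)\<alpha>\<close>, which settles the representable case because \<open>\<sim>\<close> is a congruence. In the other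
  two cases \<open>\<alpha> \<approx> \<beta>\<close> is witnessed by a single \<open>k\<close> for all \<open>a\<close>, so \<open>\<alpha>\<gamma> = \<beta>\<gamma>\<close> for all \<open>\<gamma> \<in> I\<^sup>k\<close>, hence
  \<open>\<lambda>(\<alpha>)\<gamma> = \<lambda>(\<alpha>\<gamma>) = \<lambda>(\<beta>\<gamma>) = \<lambda>(\<beta>)\<gamma>\<close>.\<close>

section \<open>Descending maps along a surjection, and the induced homomorphism of
  bi-translations\<close>

text \<open>The induced map on the image of \<open>p\<close>. The representative chosen by
  \<open>inv_into\<close> is immaterial as soon as \<open>f\<close> respects the fibres of
  \<open>p\<close>. For \<open>p\<close> = \<open>I_class X I\<close> this gives the barred maps on
  I/\<approx>.\<close>

definition descend :: "('s \<Rightarrow> 't) \<Rightarrow> 's set \<Rightarrow> ('s \<Rightarrow> 's) \<Rightarrow> 't \<Rightarrow> 't" where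
  "descend p J f = (\<lambda>c\<in>p ` J. p (f (inv_into J p c)))"

definition respects_fibres :: "('s \<Rightarrow> 't) \<Rightarrow> 's set \<Rightarrow> ('s \<Rightarrow> 's) \<Rightarrow> bool" where
  "respects_fibres p J f \<longleftrightarrow> (\<forall>x\<in>J. \<forall>y\<in>J. p x = p y \<longrightarrow> p (f x) = p (f y))"

lemma descend_apply:
  assumes "respects_fibres p J f" "x \<in> J"
  shows "descend p J f (p x) = p (f x)"
proof -
  have "inv_into J p (p x) \<in> J" "p (inv_into J p (p x)) = p x"
    using assms(2) by (auto intro: inv_into_into f_inv_into_f)
  then have "p (f (inv_into J p (p x))) = p (f x)"
    using assms unfolding respects_fibres_def by blast
  then show ?thesis using assms(2) by (simp add: descend_def)
qed

lemma descend_PiE: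
  assumes "f \<in> J \<rightarrow> J"
  shows "descend p J f \<in> p ` J \<rightarrow>\<^sub>E p ` J"
  using assms by (auto simp: descend_def inv_into_into)

lemma extensional_image_eqI:
  assumes "f \<in> extensional (p ` J)" "g \<in> extensional (p ` J)" "\<And>x. x \<in> J \<Longrightarrow> f (p x) = g (p x)"
  shows "f = g"
  using assms by (intro extensionalityI[of f "p ` J" g]) auto

lemma descend_compose:
  assumes "respects_fibres p J f" "respects_fibres p J g" "g \<in> J \<rightarrow> J"
  shows "descend p J (compose J f g) = compose (p ` J) (descend p J f) (descend p J g)"
proof (rule extensional_image_eqI)
  have "respects_fibres p J (compose J f g)"
    using assms unfolding respects_fibres_def compose_def Pi_iff by (metis restrict_apply')
  then show "descend p J (compose J f g) (p x) = compose (p ` J) (descend p J f) (descend p J g) (p x)"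
    if "x \<in> J" for x
    using assms that by (auto simp: descend_apply compose_def Pi_iff)
qed (auto simp: descend_def compose_def)

lemma OmegaD:
  assumes "(l, r) \<in> carrier (Omega J m)"
  shows "l \<in> J \<rightarrow>\<^sub>E J" "r \<in> J \<rightarrow>\<^sub>E J"
    "x \<in> J \<Longrightarrow> y \<in> J \<Longrightarrow> l (m x y) = m (l x) y"
    "x \<in> J \<Longrightarrow> y \<in> J \<Longrightarrow> r (m x y) = m x (r y)"
    "x \<in> J \<Longrightarrow> y \<in> J \<Longrightarrow> m x (l y) = m (r x) y"
  using assms
  unfolding Omega_def bi_translation_def left_translation_def right_translation_def
  by (simp_all only: partial_object.simps mem_Collect_eq prod.case)

text \<open>Every element of the image of \<open>p\<close> is some \<open>p x\<close>, and descended
  maps commute with \<open>p\<close>. Hence the three identities defining a bi-translation carry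
  over to the image, and \<open>descend_compose\<close> gives multiplicativity in each
  coordinate.\<close>

lemma descend_hom_Omega:
  assumes closed: "\<And>x y. x \<in> J \<Longrightarrow> y \<in> J \<Longrightarrow> m x y \<in> J"
    and p: "\<And>x y. x \<in> J \<Longrightarrow> y \<in> J \<Longrightarrow> m' (p x) (p y) = p (m x y)"
    and fib: "\<And>l r. (l, r) \<in> carrier (Omega J m) \<Longrightarrow> respects_fibres p J l \<and> respects_fibres p J r"
  shows "(\<lambda>(l, r). (descend p J l, descend p J r)) \<in> hom (Omega J m) (Omega (p ` J) m')"
proof (rule homI)
  fix s assume s: "s \<in> carrier (Omega J m)"
  obtain l r where lr: "s = (l, r)" by (cases s)
  note D = OmegaD[OF s[unfolded lr]]
  have maps: "l \<in> J \<rightarrow> J" "r \<in> J \<rightarrow> J" using D(1,2) by auto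
  then have in_J: "\<And>x. x \<in> J \<Longrightarrow> l x \<in> J" "\<And>x. x \<in> J \<Longrightarrow> r x \<in> J" by auto
  have "respects_fibres p J l" "respects_fibres p J r" using fib s lr by auto
  note app = this[THEN descend_apply]
  show "(case s of (l, r) \<Rightarrow> (descend p J l, descend p J r)) \<in> carrier (Omega (p ` J) m')"
    using descend_PiE[OF maps(1), of p] descend_PiE[OF maps(2), of p]
    by (simp add: lr Omega_def bi_translation_def left_translation_def right_translation_def
        app p closed in_J D(3-5) del: PiE_iff)
next
  fix s t assume s: "s \<in> carrier (Omega J m)" and t: "t \<in> carrier (Omega J m)"
  obtain l r l' r' where lr: "s = (l, r)" "t = (l', r')" by (cases s, cases t)
  \<comment> \<open>In the product the left translations compose right to left and the right ones
    left to right, so \<open>l'\<close> and \<open>r\<close> are the maps applied first, and it is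
    these that \<open>descend_compose\<close> wants to send \<open>J\<close> into itself.\<close>
  have maps: "r \<in> J \<rightarrow> J" "l' \<in> J \<rightarrow> J"
    using OmegaD(1,2)[OF s[unfolded lr]] OmegaD(1,2)[OF t[unfolded lr]] by auto
  show "(case s \<otimes>\<^bsub>Omega J m\<^esub> t of (l, r) \<Rightarrow> (descend p J l, descend p J r)) =
      (case s of (l, r) \<Rightarrow> (descend p J l, descend p J r)) \<otimes>\<^bsub>Omega (p ` J) m'\<^esub>
      (case t of (l, r) \<Rightarrow> (descend p J l, descend p J r))"
    using fib s t maps by (auto simp: lr Omega_def descend_compose)
qed

text \<open>Induction over the generated subalgebra, since both maps commute with the operations. It
  serves to compare \<alpha>\<gamma> with \<beta>\<gamma> on a finite generating set.\<close>

lemma End_eq_on_subalg_gen: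
  assumes "\<alpha> \<in> End_alg A" "\<beta> \<in> End_alg A" "subalg_gen A Y = carrier A" "\<And>y. y \<in> Y \<Longrightarrow> \<alpha> y = \<beta> y"
    and "a \<in> carrier A"
  shows "\<alpha> a = \<beta> a"
proof -
  from assms(5) have "a \<in> subalg_gen A Y" using assms(3) by simp
  then show ?thesis
  proof induction
    case (base x)
    then show ?case by (rule assms(4))
  next
    case (step f xs)
    then have "xs \<in> args A f" using assms(3) by (auto simp: args_def)
    moreover have "map \<alpha> xs = map \<beta> xs" using step by auto
    ultimately show ?case using step(1) assms(1,2) by (simp add: End_alg_def del: map_eq_conv)
  qed
qed

section \<open>Powers of \<open>I\<close> and stabilisation of the chain of relations
  \<open>sim_k\<close>\<close>

context
  fixes X :: "'a set" and I
  assumes sg: "subsemigroup_of (X \<rightarrow>\<^sub>E X) (rcomp X) I"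
begin

text \<open>Powers are defined by adding factors on the right. By associativity the first factor can
  be split off instead, which is what a recursion for \<open>sim_k\<close> requires.\<close>

lemma ipow_Suc_left:
  "ipow X I (Suc k) = {rcomp X \<alpha> \<beta> | \<alpha> \<beta>. \<alpha> \<in> I \<and> \<beta> \<in> ipow X I k}"
proof (induction k)
  case 0
  have "rcomp X \<alpha> (\<lambda>x\<in>X. x) = \<alpha>" if "\<alpha> \<in> I" for \<alpha>
    using subsetD[OF I_maps[OF sg] that]
    by (intro extensionalityI[of _ X]) (auto simp: rcomp_def compose_def PiE_def)
  then show ?case unfolding ipow_1[OF sg] by force
next
  case (Suc k)
  have assoc: "rcomp X (rcomp X \<alpha> \<beta>) \<gamma> = rcomp X \<alpha> (rcomp X \<beta> \<gamma>)" if "\<alpha> \<in> I" for \<alpha> \<beta> \<gamma>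
    using I_maps[OF sg] that by (intro rcomp_assoc) blast
  have "ipow X I (Suc (Suc k)) = {rcomp X (rcomp X \<alpha> \<beta>) \<gamma> | \<alpha> \<beta> \<gamma>. \<alpha> \<in> I \<and> \<beta> \<in> ipow X I k \<and> \<gamma> \<in> I}"
    unfolding ipow.simps(2)[of X I "Suc k"] Suc.IH by blast
  also have "\<dots> = {rcomp X \<alpha> (rcomp X \<beta> \<gamma>) | \<alpha> \<beta> \<gamma>. \<alpha> \<in> I \<and> \<beta> \<in> ipow X I k \<and> \<gamma> \<in> I}"
    using assoc by (intro Collect_cong) metis
  finally show ?case unfolding ipow.simps(2)[of X I k] by blast
qed

lemma ipow_subset: "1 \<le> k \<Longrightarrow> ipow X I k \<subseteq> I"
proof (induction k rule: dec_induct)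
  case base
  show ?case using ipow_1[OF sg] by simp
next
  case (step k)
  then show ?case using I_mult[OF sg] by auto
qed

text \<open>A product of \<open>Suc k\<close> factors is some \<alpha> in \<open>I\<close> followed
  by a product of \<open>k\<close> factors. So each relation of the chain determines the next
  one.\<close>

lemma sim_k_Suc_iff:
  "(x, y) \<in> sim_k X I (Suc k) \<longleftrightarrow> x \<in> X \<and> y \<in> X \<and> (\<forall>\<alpha>\<in>I. (\<alpha> x, \<alpha> y) \<in> sim_k X I k)"
proof -
  have "\<alpha> z \<in> X" if "\<alpha> \<in> I" "z \<in> X" for \<alpha> z using I_maps[OF sg] that by blast
  moreover have "(\<forall>\<gamma>\<in>ipow X I (Suc k). \<gamma> x = \<gamma> y) \<longleftrightarrow> (\<forall>\<alpha>\<in>I. \<forall>\<beta>\<in>ipow X I k. \<beta> (\<alpha> x) = \<beta> (\<alpha> y))"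
    if "x \<in> X" "y \<in> X"
  proof -
    have "(\<forall>\<gamma>\<in>ipow X I (Suc k). \<gamma> x = \<gamma> y) \<longleftrightarrow>
        (\<forall>\<alpha>\<in>I. \<forall>\<beta>\<in>ipow X I k. rcomp X \<alpha> \<beta> x = rcomp X \<alpha> \<beta> y)"
      unfolding ipow_Suc_left by blast
    then show ?thesis using that by (simp add: rcomp_apply)
  qed
  ultimately show ?thesis by (auto simp: sim_k_def simp del: ipow.simps)
qed

text \<open>Since each relation determines the next by \<open>sim_k_Suc_iff\<close>, one repetition
  makes the chain constant from \<open>k\<close> on; the earlier relations lie below by
  monotonicity.\<close>

lemma sim_eq_sim_k:
  assumes "1 \<le> k" "sim_k X I k = sim_k X I (Suc k)"
  shows "sim X I = sim_k X I k"
proof -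
  have stable: "sim_k X I l = sim_k X I k" if "k \<le> l" for l
    using that
  proof (induction l rule: dec_induct)
    case (step l)
    have "sim_k X I (Suc l) = sim_k X I (Suc k)"
      using step.IH by (auto simp: sim_k_Suc_iff)
    then show ?case using assms(2) by simp
  qed simp
  show ?thesis
  proof
    show "sim_k X I k \<subseteq> sim X I" using assms(1) by (auto simp: sim_def)
    have "sim_k X I l \<subseteq> sim_k X I k" for l
      using sim_k_mono[OF sg, of l "max k l"] stable[of "max k l"] by simp
    then show "sim X I \<subseteq> sim_k X I k" by (auto simp: sim_def)
  qed
qed

section \<open>How the members of a bi-translation act on \<approx>\<close>

text \<open>A left translation changes only the first factor of a product. The exponent starts at 1
  because the identity map, the sole element of the zeroth power, may lie outside
  \<open>I\<close>.\<close>

lemma left_translation_ipow: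
  assumes "left_translation I (rcomp X) l"
  shows "\<gamma> \<in> ipow X I (Suc k) \<Longrightarrow> l \<gamma> \<in> ipow X I (Suc k)"
proof (induction k arbitrary: \<gamma>)
  case 0
  then show ?case using assms unfolding ipow_1[OF sg] by (auto simp: left_translation_def)
next
  case (Suc k)
  from Suc.prems obtain \<delta> \<epsilon> where *: "\<gamma> = rcomp X \<delta> \<epsilon>" "\<delta> \<in> ipow X I (Suc k)" "\<epsilon> \<in> I"
    unfolding ipow.simps(2)[of X I "Suc k"] by blast
  then have "l \<gamma> = rcomp X (l \<delta>) \<epsilon>"
    using assms ipow_subset[of "Suc k"] by (auto simp: left_translation_def simp del: ipow.simps)
  then show ?case using Suc.IH[OF *(2)] *(3) unfolding ipow.simps(2)[of X I "Suc k"] by blast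
qed

text \<open>The exponent \<open>k\<close> that relates a\<alpha> to a\<beta> also relates their
  images under \<open>r\<close>, because testing these with \<gamma> amounts to testing a\<alpha>
  and a\<beta> with \<open>l \<gamma>\<close>.\<close>

lemma right_translation_approx:
  assumes lr: "(l, r) \<in> carrier (Omega I (rcomp X))" and ab: "(\<alpha>, \<beta>) \<in> approx X I"
  shows "(r \<alpha>, r \<beta>) \<in> approx X I"
proof -
  note D = OmegaD[OF lr]
  have I: "\<alpha> \<in> I" "\<beta> \<in> I" "r \<alpha> \<in> I" "r \<beta> \<in> I" using ab D(2) by (auto simp: approx_def)
  have "(r \<alpha> a, r \<beta> a) \<in> sim X I" if a: "a \<in> X" for a
  proof -
    from ab a obtain k where k: "1 \<le> k" "(\<alpha> a, \<beta> a) \<in> sim_k X I k"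
      by (auto simp: approx_def sim_def)
    \<comment> \<open>The linking identity of the bi-translation, evaluated at
      \<open>a\<close>.\<close>
    have eq: "\<gamma> (r \<delta> a) = l \<gamma> (\<delta> a)" if "\<gamma> \<in> I" "\<delta> \<in> I" for \<gamma> \<delta>
      using D(5)[OF that(2,1)] a by (metis rcomp_apply)
    have "\<gamma> (r \<alpha> a) = \<gamma> (r \<beta> a)" if \<gamma>: "\<gamma> \<in> ipow X I k" for \<gamma>
    proof -
      have "l \<gamma> \<in> ipow X I k"
        using lr \<gamma> left_translation_ipow[of l \<gamma> "k - 1"] k(1)
        by (simp add: Omega_def bi_translation_def)
      moreover have "\<gamma> \<in> I" using ipow_subset[OF k(1)] \<gamma> by blast
      ultimately show ?thesis using k(2) I by (auto simp: eq sim_k_def)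
    qed
    moreover have "r \<alpha> a \<in> X" "r \<beta> a \<in> X" using I_maps[OF sg] I a by blast+
    ultimately have "(r \<alpha> a, r \<beta> a) \<in> sim_k X I k" by (auto simp: sim_k_def)
    then show ?thesis using k(1) by (auto simp: sim_def)
  qed
  then show ?thesis using I by (auto simp: approx_def)
qed

text \<open>One \<open>k\<close> for all points turns the pointwise equalities into an equation
  \<alpha>\<gamma> = \<beta>\<gamma> between elements of \<open>I\<close>, and only to such an
  equation can \<open>l\<close> be applied.\<close>

lemma left_translation_approx_uniform:
  assumes lr: "(l, r) \<in> carrier (Omega I (rcomp X))" and I: "\<alpha> \<in> I" "\<beta> \<in> I"
    and k: "1 \<le> k" "\<And>a. a \<in> X \<Longrightarrow> (\<alpha> a, \<beta> a) \<in> sim_k X I k"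
  shows "(l \<alpha>, l \<beta>) \<in> approx X I"
proof -
  note D = OmegaD[OF lr]
  have I': "l \<alpha> \<in> I" "l \<beta> \<in> I" using I D(1) by auto
  have "\<gamma> (l \<alpha> a) = \<gamma> (l \<beta> a)" if a: "a \<in> X" and \<gamma>: "\<gamma> \<in> ipow X I k" for a \<gamma>
  proof -
    have "\<gamma> \<in> I" using ipow_subset[OF k(1)] \<gamma> by blast
    have "rcomp X \<alpha> \<gamma> = rcomp X \<beta> \<gamma>"
      using k(2) \<gamma> by (auto simp: rcomp_def compose_def sim_k_def fun_eq_iff)
    then have "rcomp X (l \<alpha>) \<gamma> = rcomp X (l \<beta>) \<gamma>"
      using D(3)[OF _ \<open>\<gamma> \<in> I\<close>] I by metis
    then show ?thesis using a by (metis rcomp_apply)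
  qed
  moreover have "l \<alpha> a \<in> X" "l \<beta> a \<in> X" if "a \<in> X" for a using I_maps[OF sg] I' that by blast+
  ultimately have "(l \<alpha> a, l \<beta> a) \<in> sim X I" if "a \<in> X" for a
    using k(1) that unfolding sim_def by (intro UN_I[of k]) (auto simp: sim_k_def)
  then show ?thesis using I' by (auto simp: approx_def)
qed

text \<open>By the linking identity, the value of \<open>l \<delta>\<close> at an image point
  \<open>\<gamma> b\<close> is the value of \<delta> at \<open>r \<gamma> b\<close>. At that point
  \<alpha> \<approx> \<beta> applies directly.\<close>

lemma left_translation_approx_on_image:
  assumes lr: "(l, r) \<in> carrier (Omega I (rcomp X))" and ab: "(\<alpha>, \<beta>) \<in> approx X I"
    and \<gamma>: "\<gamma> \<in> I" "b \<in> X"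
  shows "(l \<alpha> (\<gamma> b), l \<beta> (\<gamma> b)) \<in> sim X I"
proof -
  note D = OmegaD[OF lr]
  have I: "\<alpha> \<in> I" "\<beta> \<in> I" "r \<gamma> \<in> I" using ab \<gamma> D(2) by (auto simp: approx_def)
  have "l \<delta> (\<gamma> b) = \<delta> (r \<gamma> b)" if "\<delta> \<in> I" for \<delta>
    using D(5)[OF \<gamma>(1) that] \<gamma>(2) by (metis rcomp_apply)
  moreover have "r \<gamma> b \<in> X" using I_maps[OF sg] I \<gamma>(2) by blast
  ultimately show ?thesis using ab I by (auto simp: approx_def)
qed

end

section \<open>The three conditions on the algebra\<close>

context
  fixes A :: "('a, 'f) alg" and I
  assumes A: "is_alg A" and I: "subsemigroup_of (End_alg A) (rcomp (carrier A)) I"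
begin

text \<open>Take the largest of the exponents belonging to the finitely many generators. For
  \<gamma> in that power of \<open>I\<close>, the endomorphisms \<alpha>\<gamma> and \<beta>\<gamma>
  agree on the generators, hence everywhere.\<close>

lemma approx_uniform_finitely_generated:
  assumes "finitely_generated A" and ab: "(\<alpha>, \<beta>) \<in> approx (carrier A) I"
  shows "\<exists>k\<ge>1. \<forall>a\<in>carrier A. (\<alpha> a, \<beta> a) \<in> sim_k (carrier A) I k"
proof -
  note sg = subsemigroup_maps[OF I]
  obtain Y where Y: "finite Y" "Y \<subseteq> carrier A" "subalg_gen A Y = carrier A"
    using assms(1) by (auto simp: finitely_generated_def)
  have "\<exists>k. (\<alpha> y, \<beta> y) \<in> sim_k (carrier A) I k" if "y \<in> Y" for y
  proof -
    have "(\<alpha> y, \<beta> y) \<in> sim (carrier A) I" using ab Y(2) that by (auto simp: approx_def)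
    then show ?thesis unfolding sim_def by blast
  qed
  then obtain g where g: "\<And>y. y \<in> Y \<Longrightarrow> (\<alpha> y, \<beta> y) \<in> sim_k (carrier A) I (g y)" by metis
  \<comment> \<open>The inserted 1 keeps \<open>k\<close> positive and the maximum defined even when
    \<open>Y\<close> is empty.\<close>
  define k where "k = Max (insert 1 (g ` Y))"
  have "1 \<le> k" and gk: "\<And>y. y \<in> Y \<Longrightarrow> g y \<le> k" using Y(1) by (auto simp: k_def)
  have End: "\<alpha> \<in> End_alg A" "\<beta> \<in> End_alg A" using ab I by (auto simp: approx_def subsemigroup_of_def)
  have "(\<alpha> a, \<beta> a) \<in> sim_k (carrier A) I k" if a: "a \<in> carrier A" for a
  proof -
    have "\<gamma> (\<alpha> a) = \<gamma> (\<beta> a)" if \<gamma>: "\<gamma> \<in> ipow (carrier A) I k" for \<gamma>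
    proof -
      have "\<gamma> \<in> End_alg A" using ipow_End[OF A I] \<gamma> by blast
      then have "rcomp (carrier A) \<alpha> \<gamma> \<in> End_alg A" "rcomp (carrier A) \<beta> \<gamma> \<in> End_alg A"
        using End_rcomp[OF A] End by blast+
      moreover have "rcomp (carrier A) \<alpha> \<gamma> y = rcomp (carrier A) \<beta> \<gamma> y" if y: "y \<in> Y" for y
      proof -
        have "(\<alpha> y, \<beta> y) \<in> sim_k (carrier A) I k" using g[OF y] sim_k_mono[OF sg gk[OF y]] by blast
        then show ?thesis using \<gamma> y Y(2) by (auto simp: sim_k_def rcomp_apply subset_iff)
      qed
      ultimately have "rcomp (carrier A) \<alpha> \<gamma> a = rcomp (carrier A) \<beta> \<gamma> a"
        using End_eq_on_subalg_gen[OF _ _ Y(3) _ a] by blast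
      then show ?thesis using a by (simp add: rcomp_apply)
    qed
    moreover have "\<alpha> a \<in> carrier A" "\<beta> a \<in> carrier A" using End a by (auto simp: End_alg_def)
    ultimately show ?thesis by (auto simp: sim_k_def)
  qed
  then show ?thesis using \<open>1 \<le> k\<close> by blast
qed

text \<open>Induction over the subalgebra generated by the images: image points are settled by
  \<open>left_translation_approx_on_image\<close>, and operations by \<open>sim_congruence\<close>,
  as \<open>l \<alpha>\<close> and \<open>l \<beta>\<close> are endomorphisms. The exponent may vary
  from point to point.\<close>

lemma left_translation_approx_representable:
  assumes rep: "representable A I"
    and lr: "(l, r) \<in> carrier (Omega I (rcomp (carrier A)))" and ab: "(\<alpha>, \<beta>) \<in> approx (carrier A) I"
  shows "(l \<alpha>, l \<beta>) \<in> approx (carrier A) I"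
proof -
  note sg = subsemigroup_maps[OF I]
  have lI: "l \<alpha> \<in> I" "l \<beta> \<in> I" using ab OmegaD(1)[OF lr] by (auto simp: approx_def)
  then have End: "l \<alpha> \<in> End_alg A" "l \<beta> \<in> End_alg A" using I by (auto simp: subsemigroup_of_def)
  have gen: "subalg_gen A (\<Union>\<gamma>\<in>I. \<gamma> ` carrier A) = carrier A" using rep by (simp add: representable_def)
  have "(l \<alpha> a, l \<beta> a) \<in> sim (carrier A) I" if "a \<in> subalg_gen A (\<Union>\<gamma>\<in>I. \<gamma> ` carrier A)" for a
    using that
  proof induction
    case (base x)
    then show ?case using left_translation_approx_on_image[OF sg lr ab] by auto
  next
    case (step f xs)
    then have xs: "xs \<in> args A f" using gen by (auto simp: args_def)
    then have "map (l \<alpha>) xs \<in> args A f" using End(1) by (auto simp: args_def End_alg_def)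
    moreover have "list_all2 (\<lambda>x y. (x, y) \<in> sim (carrier A) I) (map (l \<alpha>) xs) (map (l \<beta>) xs)"
      using step by (auto simp: list_all2_conv_all_nth)
    ultimately have "(interp A f (map (l \<alpha>) xs), interp A f (map (l \<beta>) xs)) \<in> sim (carrier A) I"
      using sim_congruence[OF A I step(1)] by blast
    then show ?case using End step(1) xs by (simp add: End_alg_def)
  qed
  then show ?thesis using lI gen by (auto simp: approx_def)
qed

lemma left_translation_approx:
  assumes "finitely_generated A \<or> representable A I \<or> eventually_separable (carrier A) I"
    and lr: "(l, r) \<in> carrier (Omega I (rcomp (carrier A)))" and ab: "(\<alpha>, \<beta>) \<in> approx (carrier A) I"
  shows "(l \<alpha>, l \<beta>) \<in> approx (carrier A) I"
proof -
  note sg = subsemigroup_maps[OF I]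
  have uniform: ?thesis if "\<exists>k\<ge>1. \<forall>a\<in>carrier A. (\<alpha> a, \<beta> a) \<in> sim_k (carrier A) I k"
  proof -
    have "\<alpha> \<in> I" "\<beta> \<in> I" using ab by (auto simp: approx_def)
    then show ?thesis using that left_translation_approx_uniform[OF sg lr] by blast
  qed
  consider "finitely_generated A" | "representable A I" | "eventually_separable (carrier A) I"
    using assms(1) by blast
  then show ?thesis
  proof cases
    case 1
    show ?thesis by (rule uniform[OF approx_uniform_finitely_generated[OF 1 ab]])
  next
    case 2
    then show ?thesis using lr ab by (rule left_translation_approx_representable)
  next
    case 3
    then obtain k where "1 \<le> k" "sim_k (carrier A) I k = sim_k (carrier A) I (Suc k)"
      unfolding eventually_separable_def Suc_eq_plus1 by blast
    \<comment> \<open>After stabilisation \<alpha> \<approx> \<beta> is itself a statement about the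
      single exponent \<open>k\<close>.\<close>
    then have "sim (carrier A) I = sim_k (carrier A) I k" by (intro sim_eq_sim_k[OF sg])
    then have "\<forall>a\<in>carrier A. (\<alpha> a, \<beta> a) \<in> sim_k (carrier A) I k" using ab by (simp add: approx_def)
    then show ?thesis using uniform \<open>1 \<le> k\<close> by blast
  qed
qed

end

section \<open>The homomorphism \<sigma> and its values on pairs coming from the idealiser\<close>

theorem proposition4p12:
  fixes A :: "('a, 'f) alg" and I :: "('a \<Rightarrow> 'a) set"
  defines "X \<equiv> carrier A"
  defines "XQ \<equiv> carrier A // sim (carrier A) I"
  defines "IQ \<equiv> I_quot (carrier A) I"
  assumes "is_alg A"
    and "subsemigroup_of (End_alg A) (rcomp X) I"
    and "finitely_generated A \<or> representable A I \<or> eventually_separable X I"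
  shows "\<exists>\<sigma>. \<sigma> \<in> hom (Omega I (rcomp X)) (Omega IQ (rcomp XQ)) \<and>
    (\<forall>l r. (l, r) \<in> carrier (Omega I (rcomp X)) \<longrightarrow>
       (\<forall>\<alpha> \<beta>. (\<alpha>, \<beta>) \<in> approx X I \<longrightarrow> (l \<alpha>, l \<beta>) \<in> approx X I \<and> (r \<alpha>, r \<beta>) \<in> approx X I) \<and>
       (\<exists>l' r'. \<sigma> (l, r) = (l', r') \<and>
          (\<forall>\<alpha>\<in>I. l' (I_class X I \<alpha>) = I_class X I (l \<alpha>) \<and> r' (I_class X I \<alpha>) = I_class X I (r \<alpha>)))) \<and>
    (\<forall>\<phi>\<in>idealiser X I.
       \<sigma> (lam X I \<phi>, rho X I \<phi>) = (lam XQ IQ (bar_map X I \<phi>), rho XQ IQ (bar_map X I \<phi>)))"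
proof -
  have sg: "subsemigroup_of (X \<rightarrow>\<^sub>E X) (rcomp X) I"
    using assms(5) unfolding X_def by (rule subsemigroup_maps)
  \<comment> \<open>The projection of \<open>I\<close> onto I/\<approx>, realised as maps of the
    quotient. Its fibres are the \<approx>-classes by \<open>I_class_eq_iff\<close>, so respecting
    fibres means preserving \<approx>.\<close>
  let ?p = "I_class X I"
  let ?\<sigma> = "\<lambda>(l, r). (descend ?p I l, descend ?p I r)"
  have XQ: "XQ = X // sim X I" and IQ: "IQ = ?p ` I"
    using I_quot_eq[OF sg] by (simp_all add: XQ_def IQ_def X_def)
  have ap: "(l \<alpha>, l \<beta>) \<in> approx X I" "(r \<alpha>, r \<beta>) \<in> approx X I"
    if "(l, r) \<in> carrier (Omega I (rcomp X))" "(\<alpha>, \<beta>) \<in> approx X I" for l r \<alpha> \<beta>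
    using left_translation_approx[OF assms(4) assms(5)[unfolded X_def] assms(6)[unfolded X_def]]
      right_translation_approx[OF sg] that by (auto simp: X_def)
  have fib: "respects_fibres ?p I l \<and> respects_fibres ?p I r"
    if lr: "(l, r) \<in> carrier (Omega I (rcomp X))" for l r
  proof -
    have "l \<alpha> \<in> I" "r \<alpha> \<in> I" if "\<alpha> \<in> I" for \<alpha> using OmegaD(1,2)[OF lr] that by auto
    then show ?thesis using ap[OF lr] by (simp add: respects_fibres_def I_class_eq_iff[OF sg])
  qed
  have hom: "?\<sigma> \<in> hom (Omega I (rcomp X)) (Omega IQ (rcomp XQ))"
    unfolding IQ using I_mult[OF sg] I_class_mult[OF sg] fib
    by (intro descend_hom_Omega) (auto simp: XQ)
  have part2: "?\<sigma> (lam X I \<phi>, rho X I \<phi>) = (lam XQ IQ (bar_map X I \<phi>), rho XQ IQ (bar_map X I \<phi>))"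
    if \<phi>: "\<phi> \<in> idealiser X I" for \<phi>
  proof -
    have fibs: "respects_fibres ?p I (lam X I \<phi>)" "respects_fibres ?p I (rho X I \<phi>)"
      using fib[OF lam_rho_bi_translation[OF sg \<phi>]] by auto
    \<comment> \<open>On \<open>I\<close> the projection coincides with \<open>bar_map\<close>,
      which is multiplicative on products that stay in the idealiser.\<close>
    have mult: "rcomp XQ (bar_map X I \<phi>) (?p \<alpha>) = ?p (rcomp X \<phi> \<alpha>)"
      "rcomp XQ (?p \<alpha>) (bar_map X I \<phi>) = ?p (rcomp X \<alpha> \<phi>)" if \<alpha>: "\<alpha> \<in> I" for \<alpha>
    proof -
      have i: "rcomp X \<phi> \<alpha> \<in> I" "rcomp X \<alpha> \<phi> \<in> I" using idealiserD[OF sg \<phi>] \<alpha> by simp_all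
      then have j: "\<alpha> \<in> idealiser X I" "rcomp X \<phi> \<alpha> \<in> idealiser X I" "rcomp X \<alpha> \<phi> \<in> idealiser X I"
        using \<alpha> I_idealiser[OF sg] by blast+
      show "rcomp XQ (bar_map X I \<phi>) (?p \<alpha>) = ?p (rcomp X \<phi> \<alpha>)"
        "rcomp XQ (?p \<alpha>) (bar_map X I \<phi>) = ?p (rcomp X \<alpha> \<phi>)"
        using bar_map_mult[OF sg \<phi> j(1,2)] bar_map_mult[OF sg j(1) \<phi> j(3)] \<alpha> i
        by (simp_all add: XQ I_class_bar_map[OF sg])
    qed
    \<comment> \<open>Both sides are extensional on I/\<approx>, and both send the class of \<alpha>
      to the class of \<phi>\<alpha>.\<close>
    have "descend ?p I (lam X I \<phi>) = lam XQ IQ (bar_map X I \<phi>)"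
    proof (rule extensional_image_eqI)
      show "descend ?p I (lam X I \<phi>) (?p \<alpha>) = lam XQ IQ (bar_map X I \<phi>) (?p \<alpha>)" if "\<alpha> \<in> I" for \<alpha>
        using that fibs(1) by (simp add: descend_apply) (simp add: lam_def IQ mult)
    qed (auto simp: descend_def lam_def IQ)
    moreover have "descend ?p I (rho X I \<phi>) = rho XQ IQ (bar_map X I \<phi>)"
    proof (rule extensional_image_eqI)
      show "descend ?p I (rho X I \<phi>) (?p \<alpha>) = rho XQ IQ (bar_map X I \<phi>) (?p \<alpha>)" if "\<alpha> \<in> I" for \<alpha>
        using that fibs(2) by (simp add: descend_apply) (simp add: rho_def IQ mult)
    qed (auto simp: descend_def rho_def IQ)
    ultimately show ?thesis by simp
  qed
  show ?thesis
    using hom ap fib part2 by (intro exI[of _ ?\<sigma>]) (simp add: descend_apply)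
qed

end
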